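(* Let $X,Y$ be non-empty sets, let $a$ be a function from $Y$ to $X$, let $A=\operatorname{im}(a)$ and $\sigma=\ker(a)$, and let $\mathcal T_{XY}^a=(\mathcal T_{XY},\star_a)$, where $f\star_ag=fag$. Consider the map $$\psi:\operatorname{Reg}(\mathcal T_{XY}^a)\to\operatorname{Reg}(\mathcal T(X,A))\times\operatorname{Reg}(\mathcal T(Y,\sigma)):f\mapsto(fa,af).$$ Then $\psi$ is injective, and $$\operatorname{im}(\psi)=\{(g,h)\in\operatorname{Reg}(\mathcal T(X,A))\times\operatorname{Reg}(\mathcal T(Y,\sigma)): ag=ha\}.$$ In particular, $\operatorname{Reg}(\mathcal T_{XY}^a)$ is a pullback product of $\operatorname{Reg}(\mathcal T(X,A))$ and $\operatorname{Reg}(\mathcal T(Y,\sigma))$ with respect to $\mathcal T_A$.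
   Context: Maps are written on the right and composed left to right. $\mathcal T_{CD}$ is the set of all (totally defined) functions $C\to D$, and $\mathcal T_C=\mathcal T_{CC}$ is the full transformation semigroup under composition. $\ker(f)=\{(x,y): xf=yf\}$. Define $$\mathcal T(X,A)=\{f\in\mathcal T_X:\operatorname{im}(f)\subseteq A\},\qquad\mathcal T(Y,\sigma)=\{f\in\mathcal T_Y:\ker(f)\supseteq\sigma\},$$ semigroups under composition. For a semigroup $T$, $\operatorname{Reg}(T)=\{x\in T: x=xyx\text{ for some }y\in T\}$; for the three semigroups in the statement, $\operatorname{Reg}$ is a subsemigroup. A semigroup $S$ is a pullback product of semigroups $S_1,S_2$ with respect to a semigroup $T$ if there are surjective homomorphisms $\theta_1:S_1\to T$, $\theta_2:S_2\to T$ such that $S$ is isomorphic to the subsemigroup $\{(s_1,s_2)\in S_1\times S_2: s_1\theta_1=s_2\theta_2\}$ of $S_1\times S_2$. Here the isomorphism onto this subsemigroup is $\psi$, and the maps are $\theta_1:g\mapsto(bag)|_A$ and $\theta_2:h\mapsto(bha)|_A$, where $b\in\mathcal T_{XY}$ is any fixed function with $aba=a$ and $bab=b$. *)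

theory Defs
  imports "HOL-Algebra.Group"
begin

text \<open>
  A map \<open>C \<rightarrow> D\<close> is an element of \<^term>\<open>C \<rightarrow>\<^sub>E D\<close>, so that equality of maps is equality in HOL.
  In the source, maps are written on the right and composed from left to right; the composite
  \<open>f g\<close> (first \<open>f\<close>, with domain \<open>C\<close>, then \<open>g\<close>) is \<^term>\<open>compose C g f\<close>.

  Semigroups are monoid records whose \<open>one\<close> field is meaningless (\<^term>\<open>undefined\<close>). The library
  notions \<^const>\<open>hom\<close>, \<^const>\<open>epi\<close>, \<^const>\<open>iso\<close> and (up to the \<open>one\<close> field) \<^const>\<open>DirProd\<close>
  only depend on the carrier and the multiplication.
\<close>

definition is_semigroup :: "('a, 'm) monoid_scheme \<Rightarrow> bool" where
  "is_semigroup S \<longleftrightarrow>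
     (\<forall>x\<in>carrier S. \<forall>y\<in>carrier S. x \<otimes>\<^bsub>S\<^esub> y \<in> carrier S) \<and>
     (\<forall>x\<in>carrier S. \<forall>y\<in>carrier S. \<forall>z\<in>carrier S.
        (x \<otimes>\<^bsub>S\<^esub> y) \<otimes>\<^bsub>S\<^esub> z = x \<otimes>\<^bsub>S\<^esub> (y \<otimes>\<^bsub>S\<^esub> z))"

definition Reg :: "('a, 'm) monoid_scheme \<Rightarrow> ('a, 'm) monoid_scheme" where
  "Reg S = S\<lparr>carrier := {x \<in> carrier S. \<exists>y\<in>carrier S. x = x \<otimes>\<^bsub>S\<^esub> y \<otimes>\<^bsub>S\<^esub> x}\<rparr>"

definition full_trans :: "'a set \<Rightarrow> ('a \<Rightarrow> 'a) monoid" where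
  "full_trans C = \<lparr>carrier = C \<rightarrow>\<^sub>E C, mult = (\<lambda>f g. compose C g f), one = undefined\<rparr>"

definition ker_on :: "'a set \<Rightarrow> ('a \<Rightarrow> 'b) \<Rightarrow> ('a \<times> 'a) set" where
  "ker_on C f = {(x, y). x \<in> C \<and> y \<in> C \<and> f x = f y}"

definition trans_im :: "'a set \<Rightarrow> 'a set \<Rightarrow> ('a \<Rightarrow> 'a) monoid" where
  "trans_im X A = (full_trans X)\<lparr>carrier := {f \<in> carrier (full_trans X). f ` X \<subseteq> A}\<rparr>"

definition trans_ker :: "'b set \<Rightarrow> ('b \<times> 'b) set \<Rightarrow> ('b \<Rightarrow> 'b) monoid" where
  "trans_ker Y \<sigma> = (full_trans Y)\<lparr>carrier := {f \<in> carrier (full_trans Y). ker_on Y f \<supseteq> \<sigma>}\<rparr>"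

definition sandwich :: "'a set \<Rightarrow> 'b set \<Rightarrow> ('b \<Rightarrow> 'a) \<Rightarrow> ('a \<Rightarrow> 'b) monoid" where
  "sandwich X Y a =
     \<lparr>carrier = X \<rightarrow>\<^sub>E Y, mult = (\<lambda>f g. compose X g (compose X a f)), one = undefined\<rparr>"

definition pullback ::
    "('a, 'm) monoid_scheme \<Rightarrow> ('b, 'n) monoid_scheme \<Rightarrow> ('a \<Rightarrow> 'c) \<Rightarrow> ('b \<Rightarrow> 'c) \<Rightarrow> ('a \<times> 'b) monoid" where
  "pullback S1 S2 \<theta>1 \<theta>2 =
     (S1 \<times>\<times> S2)\<lparr>carrier := {(s1, s2) \<in> carrier S1 \<times> carrier S2. \<theta>1 s1 = \<theta>2 s2}\<rparr>"

definition pullback_product_via ::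
    "('s, 'k) monoid_scheme \<Rightarrow> ('a, 'm) monoid_scheme \<Rightarrow> ('b, 'n) monoid_scheme \<Rightarrow> ('c, 'l) monoid_scheme
      \<Rightarrow> ('a \<Rightarrow> 'c) \<Rightarrow> ('b \<Rightarrow> 'c) \<Rightarrow> ('s \<Rightarrow> 'a \<times> 'b) \<Rightarrow> bool" where
  "pullback_product_via S S1 S2 T \<theta>1 \<theta>2 \<psi> \<longleftrightarrow>
     is_semigroup S \<and> is_semigroup S1 \<and> is_semigroup S2 \<and> is_semigroup T \<and>
     \<theta>1 \<in> epi S1 T \<and> \<theta>2 \<in> epi S2 T \<and> \<psi> \<in> iso S (pullback S1 S2 \<theta>1 \<theta>2)"

definition is_pullback_product ::
    "('s, 'k) monoid_scheme \<Rightarrow> ('a, 'm) monoid_scheme \<Rightarrow> ('b, 'n) monoid_scheme \<Rightarrow> ('c, 'l) monoid_scheme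
      \<Rightarrow> bool" where
  "is_pullback_product S S1 S2 T \<longleftrightarrow> (\<exists>\<theta>1 \<theta>2 \<psi>. pullback_product_via S S1 S2 T \<theta>1 \<theta>2 \<psi>)"

end

theory Submission
  imports Defs
begin

text \<open>
  Regularity in the three semigroups is an image condition: \<open>f\<close> is regular in the sandwich semigroup
  iff \<open>f(X) = f(A)\<close> and \<open>a\<close> is injective on \<open>f(X)\<close>; \<open>g\<close> is regular in \<open>T(X,A)\<close> iff \<open>g(X) = g(A)\<close>;
  and \<open>h\<close> is regular in \<open>T(Y,\<sigma>)\<close> iff \<open>a\<close> is injective on \<open>h(Y)\<close>. Given a compatible pair \<open>(g, h)\<close>,
  every \<open>g(x)\<close> has the form \<open>a(h(y))\<close>, and the point \<open>h(y)\<close> is determined by \<open>x\<close>; sending \<open>x\<close> to it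
  gives the unique regular preimage of \<open>(g, h)\<close>. Finally \<open>\<theta>1\<close> is just restriction to \<open>A\<close>, since
  \<open>a \<circ> b\<close> fixes \<open>A\<close> pointwise.
\<close>

section \<open>Carriers, products and equality of extensional maps\<close>

lemma carrier_full_trans: "carrier (full_trans C) = C \<rightarrow>\<^sub>E C"
  by (simp add: full_trans_def)

lemma mult_full_trans: "f \<otimes>\<^bsub>full_trans C\<^esub> g = compose C g f"
  by (simp add: full_trans_def)

lemma mult_Reg: "x \<otimes>\<^bsub>Reg S\<^esub> y = x \<otimes>\<^bsub>S\<^esub> y"
  by (simp add: Reg_def)

lemma carrier_Reg:
  "x \<in> carrier (Reg S) \<longleftrightarrow> x \<in> carrier S \<and> (\<exists>y\<in>carrier S. x = x \<otimes>\<^bsub>S\<^esub> y \<otimes>\<^bsub>S\<^esub> x)"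
  by (simp add: Reg_def)

lemma mult_trans_im: "f \<otimes>\<^bsub>trans_im X A\<^esub> g = compose X g f"
  by (simp add: trans_im_def full_trans_def)

lemma mult_trans_ker: "f \<otimes>\<^bsub>trans_ker Y \<sigma>\<^esub> g = compose Y g f"
  by (simp add: trans_ker_def full_trans_def)

lemma mult_sandwich: "f \<otimes>\<^bsub>sandwich X Y a\<^esub> g = compose X g (compose X a f)"
  by (simp add: sandwich_def)

lemma PiE_eq_iff:
  assumes "f \<in> A \<rightarrow>\<^sub>E B" and "g \<in> A \<rightarrow>\<^sub>E C"
  shows "f = g \<longleftrightarrow> (\<forall>x\<in>A. f x = g x)"
  using assms by (auto simp: PiE_iff intro: extensionalityI)

lemma compose_PiE:
  assumes "\<And>x. x \<in> A \<Longrightarrow> g (f x) \<in> C"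
  shows "compose A g f \<in> A \<rightarrow>\<^sub>E C"
  using assms by (auto simp: compose_def)

section \<open>Regular elements of the three semigroups\<close>

text \<open>If \<open>f (a (g (a (f x)))) = f x\<close> on X, every value of f is attained on a(Y),
  and \<open>f x\<close> can be recovered from \<open>a (f x)\<close>. Conversely, g only has to
  send each \<open>a (f x)\<close> to some w with \<open>a (f (a w)) = a (f x)\<close>; the image
  condition provides w, and injectivity cancels the outer a.\<close>

lemma carrier_Reg_sandwich:
  assumes a: "a \<in> Y \<rightarrow>\<^sub>E X" and Y: "Y \<noteq> {}"
  shows "f \<in> carrier (Reg (sandwich X Y a)) \<longleftrightarrow>
    f \<in> X \<rightarrow>\<^sub>E Y \<and> f ` X \<subseteq> f ` a ` Y \<and> inj_on a (f ` X)"
proof -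
  have carr: "f \<in> carrier (sandwich X Y a) \<longleftrightarrow> f \<in> X \<rightarrow>\<^sub>E Y" for f
    by (simp add: sandwich_def)
  have "f \<in> carrier (Reg (sandwich X Y a)) \<longleftrightarrow>
      f \<in> X \<rightarrow>\<^sub>E Y \<and> (\<exists>g\<in>X \<rightarrow>\<^sub>E Y. \<forall>x\<in>X. f (a (g (a (f x)))) = f x)" (is "_ \<longleftrightarrow> ?R")
  proof -
    have "f = compose X f (compose X a (compose X g (compose X a f))) \<longleftrightarrow>
        (\<forall>x\<in>X. f (a (g (a (f x)))) = f x)" if "f \<in> X \<rightarrow>\<^sub>E Y" "g \<in> X \<rightarrow>\<^sub>E Y" for g
      using that a by (subst PiE_eq_iff[of _ X Y _ Y]) (auto intro!: compose_PiE simp: compose_def PiE_iff)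
    then show ?thesis
      unfolding carrier_Reg mult_sandwich Bex_def carr by blast
  qed
  also have "?R \<longleftrightarrow> f \<in> X \<rightarrow>\<^sub>E Y \<and> f ` X \<subseteq> f ` a ` Y \<and> inj_on a (f ` X)"
  proof (intro conj_cong refl iffI conjI)
    assume f: "f \<in> X \<rightarrow>\<^sub>E Y" and "\<exists>g\<in>X \<rightarrow>\<^sub>E Y. \<forall>x\<in>X. f (a (g (a (f x)))) = f x"
    then obtain g where g: "g \<in> X \<rightarrow>\<^sub>E Y" and eq: "\<And>x. x \<in> X \<Longrightarrow> f (a (g (a (f x)))) = f x"
      by blast
    show "f ` X \<subseteq> f ` a ` Y"
    proof (intro image_subsetI)
      fix x assume x: "x \<in> X"
      then have "g (a (f x)) \<in> Y" using a f g by (auto simp: PiE_iff)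
      then show "f x \<in> f ` a ` Y" using eq[OF x] by (metis imageI)
    qed
    show "inj_on a (f ` X)"
      by (rule inj_onI) (metis eq imageE)
  next
    assume f: "f \<in> X \<rightarrow>\<^sub>E Y" and "f ` X \<subseteq> f ` a ` Y \<and> inj_on a (f ` X)"
    then have im: "f ` X \<subseteq> f ` a ` Y" and inj: "inj_on a (f ` X)" by auto
    \<comment> \<open>The admissible values w of the inner inverse at x. The requirement mentions
      only x, so a choice made at \<open>a (f x)\<close> does not depend on which point x produced
      it.\<close>
    define P where "P x w \<longleftrightarrow> w \<in> Y \<and> a (f (a w)) = x" for x w
    obtain y0 where y0: "y0 \<in> Y" using Y by blast
    \<comment> \<open>The default \<open>y0\<close> keeps g total with values in Y at points that
      have no admissible value.\<close>
    define g where "g = (\<lambda>x\<in>X. if \<exists>w. P x w then SOME w. P x w else y0)"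
    have P: "P x (g x)" if "x \<in> X" "P x w" for x w
      using that someI[of "P x" w] by (auto simp: g_def)
    have "g x \<in> Y" if "x \<in> X" for x
      using P[OF that] y0 that by (cases "\<exists>w. P x w") (auto simp: P_def g_def)
    then have "g \<in> X \<rightarrow>\<^sub>E Y" by (auto simp: g_def)
    moreover have "f (a (g (a (f x)))) = f x" if x: "x \<in> X" for x
    proof -
      obtain w where w: "w \<in> Y" "f x = f (a w)" using im x by blast
      have afx: "a (f x) \<in> X" using a f x by auto
      have "P (a (f x)) (g (a (f x)))" using P[OF afx, of w] w by (simp add: P_def)
      then have *: "g (a (f x)) \<in> Y" "a (f (a (g (a (f x))))) = a (f x)" by (auto simp: P_def)
      moreover have "a (g (a (f x))) \<in> X" using * a by auto
      ultimately show ?thesis using inj x by (metis imageI inj_onD)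
    qed
    ultimately show "\<exists>g\<in>X \<rightarrow>\<^sub>E Y. \<forall>x\<in>X. f (a (g (a (f x)))) = f x" by blast
  qed
  finally show ?thesis .
qed

text \<open>An inner inverse k takes its values in A, so \<open>g (k (g x)) = g x\<close> places
  every value of g in g(A). Conversely, a choice of preimages under the restriction of g to A is an
  inner inverse.\<close>

lemma carrier_Reg_trans_im:
  assumes A: "A \<subseteq> X" "A \<noteq> {}"
  shows "g \<in> carrier (Reg (trans_im X A)) \<longleftrightarrow> g \<in> X \<rightarrow>\<^sub>E A \<and> g ` X \<subseteq> g ` A"
proof -
  have carr: "f \<in> carrier (trans_im X A) \<longleftrightarrow> f \<in> X \<rightarrow>\<^sub>E A" for f
    using A by (auto simp: trans_im_def full_trans_def PiE_iff)
  have "g \<in> carrier (Reg (trans_im X A)) \<longleftrightarrow>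
      g \<in> X \<rightarrow>\<^sub>E A \<and> (\<exists>k\<in>X \<rightarrow>\<^sub>E A. \<forall>x\<in>X. g (k (g x)) = g x)" (is "_ \<longleftrightarrow> ?R")
  proof -
    have "g = compose X g (compose X k g) \<longleftrightarrow> (\<forall>x\<in>X. g (k (g x)) = g x)"
      if g: "g \<in> X \<rightarrow>\<^sub>E A" and k: "k \<in> X \<rightarrow>\<^sub>E A" for k
    proof -
      have "g (k (g x)) \<in> A" if "x \<in> X" for x
        using that g k A by (meson PiE_mem subsetD)
      then show ?thesis
        using g by (subst PiE_eq_iff[of _ X A _ A]) (auto intro!: compose_PiE simp: compose_def)
    qed
    then show ?thesis
      unfolding carrier_Reg mult_trans_im Bex_def carr by blast
  qed
  also have "?R \<longleftrightarrow> g \<in> X \<rightarrow>\<^sub>E A \<and> g ` X \<subseteq> g ` A"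
  proof (intro conj_cong refl iffI conjI)
    assume g: "g \<in> X \<rightarrow>\<^sub>E A" and "\<exists>k\<in>X \<rightarrow>\<^sub>E A. \<forall>x\<in>X. g (k (g x)) = g x"
    then obtain k where k: "k \<in> X \<rightarrow>\<^sub>E A" and eq: "\<And>x. x \<in> X \<Longrightarrow> g (k (g x)) = g x"
      by blast
    show "g ` X \<subseteq> g ` A"
    proof (intro image_subsetI)
      fix x assume x: "x \<in> X"
      then have "k (g x) \<in> A" using A g k by (meson PiE_mem subsetD)
      then show "g x \<in> g ` A" using eq[OF x] by (metis imageI)
    qed
  next
    assume g: "g \<in> X \<rightarrow>\<^sub>E A" and im: "g ` X \<subseteq> g ` A"
    obtain z where z: "z \<in> A" using A by blast
    \<comment> \<open>Preimages are taken inside A, and the default z also lies in A, since k itself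
      must map into A.\<close>
    define k where "k = (\<lambda>x\<in>X. if x \<in> g ` A then inv_into A g x else z)"
    have "k \<in> X \<rightarrow>\<^sub>E A" using z by (auto simp: k_def inv_into_into)
    moreover have "g (k (g x)) = g x" if x: "x \<in> X" for x
    proof -
      have "g x \<in> g ` A" "g x \<in> X" using g im x A by auto
      then show ?thesis by (simp add: k_def f_inv_into_f)
    qed
    ultimately show "\<exists>k\<in>X \<rightarrow>\<^sub>E A. \<forall>x\<in>X. g (k (g x)) = g x" by blast
  qed
  finally show ?thesis .
qed

lemma ker_on_subsetD:
  assumes "ker_on Y a \<subseteq> ker_on Y h" and "y \<in> Y" "z \<in> Y" "a y = a z"
  shows "h y = h z"
  using assms by (auto simp: ker_on_def)

text \<open>An inner inverse k is constant on the fibres of a, so \<open>h y = h (k (h y))\<close>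
  depends only on \<open>a (h y)\<close>. Conversely, k may choose, from \<open>a (h y)\<close>
  alone, some z with \<open>a (h z) = a (h y)\<close>; injectivity then gives
  \<open>h z = h y\<close>.\<close>

lemma carrier_Reg_trans_ker:
  fixes a :: "'b \<Rightarrow> 'a"
  assumes Y: "Y \<noteq> {}"
  shows "h \<in> carrier (Reg (trans_ker Y (ker_on Y a))) \<longleftrightarrow>
    h \<in> Y \<rightarrow>\<^sub>E Y \<and> ker_on Y a \<subseteq> ker_on Y h \<and> inj_on a (h ` Y)"
proof -
  have carr: "f \<in> carrier (trans_ker Y (ker_on Y a)) \<longleftrightarrow> f \<in> Y \<rightarrow>\<^sub>E Y \<and> ker_on Y a \<subseteq> ker_on Y f" for f
    by (auto simp: trans_ker_def full_trans_def)
  have "h \<in> carrier (Reg (trans_ker Y (ker_on Y a))) \<longleftrightarrow>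
      (h \<in> Y \<rightarrow>\<^sub>E Y \<and> ker_on Y a \<subseteq> ker_on Y h) \<and>
      (\<exists>k\<in>Y \<rightarrow>\<^sub>E Y. ker_on Y a \<subseteq> ker_on Y k \<and> (\<forall>y\<in>Y. h (k (h y)) = h y))"
    (is "_ \<longleftrightarrow> ?R")
  proof -
    have "h = compose Y h (compose Y k h) \<longleftrightarrow> (\<forall>y\<in>Y. h (k (h y)) = h y)"
      if "h \<in> Y \<rightarrow>\<^sub>E Y" "k \<in> Y \<rightarrow>\<^sub>E Y" for k
      using that
      by (subst PiE_eq_iff[of _ Y Y _ Y]) (auto intro!: compose_PiE simp: compose_def PiE_iff)
    then show ?thesis
      unfolding carrier_Reg mult_trans_ker Bex_def carr by blast
  qed
  also have "?R \<longleftrightarrow> (h \<in> Y \<rightarrow>\<^sub>E Y \<and> ker_on Y a \<subseteq> ker_on Y h) \<and> inj_on a (h ` Y)"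
  proof (intro conj_cong refl iffI conjI)
    assume h: "h \<in> Y \<rightarrow>\<^sub>E Y \<and> ker_on Y a \<subseteq> ker_on Y h"
      and "\<exists>k\<in>Y \<rightarrow>\<^sub>E Y. ker_on Y a \<subseteq> ker_on Y k \<and> (\<forall>y\<in>Y. h (k (h y)) = h y)"
    then obtain k where k: "ker_on Y a \<subseteq> ker_on Y k" and eq: "\<And>y. y \<in> Y \<Longrightarrow> h (k (h y)) = h y"
      by blast
    show "inj_on a (h ` Y)"
    proof (rule inj_onI, elim imageE)
      fix u v y z assume "a u = a v" "u = h y" "v = h z" and yz: "y \<in> Y" "z \<in> Y"
      moreover have "h y \<in> Y" "h z \<in> Y" using h yz by auto
      ultimately have "k u = k v" using ker_on_subsetD[OF k] by metis
      then show "u = v" using eq yz \<open>u = h y\<close> \<open>v = h z\<close> by metis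
    qed
  next
    assume h: "h \<in> Y \<rightarrow>\<^sub>E Y \<and> ker_on Y a \<subseteq> ker_on Y h" and inj: "inj_on a (h ` Y)"
    define P where "P x z \<longleftrightarrow> z \<in> Y \<and> a (h z) = x" for x z
    obtain y0 where y0: "y0 \<in> Y" using Y by blast
    define c where "c x = (if \<exists>z. P x z then SOME z. P x z else y0)" for x
    \<comment> \<open>Factoring k through a makes its kernel contain that of a.\<close>
    define k where "k = (\<lambda>y\<in>Y. c (a y))"
    have P: "P x (c x)" if "P x z" for x z
      using that someI[of "P x" z] by (auto simp: c_def)
    have "c x \<in> Y" for x
      using P[of x] y0 by (cases "\<exists>z. P x z") (auto simp: P_def c_def)
    then have "k \<in> Y \<rightarrow>\<^sub>E Y" by (auto simp: k_def)
    moreover have "ker_on Y a \<subseteq> ker_on Y k" by (auto simp: ker_on_def k_def)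
    moreover have "h (k (h y)) = h y" if y: "y \<in> Y" for y
    proof -
      have hy: "h y \<in> Y" using h y by auto
      have "P (a (h y)) (c (a (h y)))" using P[of "a (h y)" y] y by (simp add: P_def)
      then have "P (a (h y)) (k (h y))" using hy by (simp add: k_def)
      then show ?thesis using inj y by (auto simp: P_def dest: inj_onD)
    qed
    ultimately show "\<exists>k\<in>Y \<rightarrow>\<^sub>E Y. ker_on Y a \<subseteq> ker_on Y k \<and> (\<forall>y\<in>Y. h (k (h y)) = h y)" by blast
  qed
  finally show ?thesis by simp
qed

section \<open>Closure of the regular elements under multiplication\<close>

lemma is_semigroup_full_trans: "is_semigroup (full_trans C)"
  by (auto simp: is_semigroup_def carrier_full_trans mult_full_trans compose_def fun_eq_iff PiE_iff)

text \<open>The product inherits the image condition from its first factor f, and injectivity of a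
  from its second factor g, whose image contains that of the product.\<close>

lemma is_semigroup_Reg_sandwich:
  assumes a: "a \<in> Y \<rightarrow>\<^sub>E X" and Y: "Y \<noteq> {}"
  shows "is_semigroup (Reg (sandwich X Y a))"
  unfolding is_semigroup_def mult_Reg mult_sandwich
proof (intro conjI ballI)
  fix f g assume "f \<in> carrier (Reg (sandwich X Y a))" "g \<in> carrier (Reg (sandwich X Y a))"
  then have f: "f \<in> X \<rightarrow>\<^sub>E Y" "f ` X \<subseteq> f ` a ` Y" and g: "g \<in> X \<rightarrow>\<^sub>E Y" "inj_on a (g ` X)"
    by (simp_all add: carrier_Reg_sandwich[OF a Y])
  let ?p = "compose X g (compose X a f)"
  have p: "?p x = g (a (f x))" if "x \<in> X" for x using that by (simp add: compose_def)
  have aY: "a ` Y \<subseteq> X" using a by auto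
  have "?p \<in> X \<rightarrow>\<^sub>E Y"
    using a f g by (intro compose_PiE) (auto simp: compose_def PiE_iff)
  moreover have "?p ` X \<subseteq> ?p ` a ` Y"
  proof (intro image_subsetI)
    fix x assume x: "x \<in> X"
    then obtain y where "y \<in> Y" "f x = f (a y)" using f by blast
    then have "?p x = ?p (a y)" using x aY by (simp add: p image_subset_iff)
    then show "?p x \<in> ?p ` a ` Y" using \<open>y \<in> Y\<close> by blast
  qed
  moreover have "?p ` X \<subseteq> g ` X"
    using a f by (auto simp: p PiE_iff)
  then have "inj_on a (?p ` X)" by (rule inj_on_subset[OF g(2)])
  ultimately show "?p \<in> carrier (Reg (sandwich X Y a))"
    by (simp add: carrier_Reg_sandwich[OF a Y])
next
  fix f g h assume "f \<in> carrier (Reg (sandwich X Y a))" "g \<in> carrier (Reg (sandwich X Y a))"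
  then have "f \<in> X \<rightarrow>\<^sub>E Y" "g \<in> X \<rightarrow>\<^sub>E Y" by (simp_all add: carrier_Reg_sandwich[OF a Y])
  then show "compose X h (compose X a (compose X g (compose X a f))) =
      compose X (compose X h (compose X a g)) (compose X a f)"
    using a by (auto simp: compose_def fun_eq_iff PiE_iff)
qed

lemma is_semigroup_Reg_trans_im:
  assumes A: "A \<subseteq> X" "A \<noteq> {}"
  shows "is_semigroup (Reg (trans_im X A))"
  unfolding is_semigroup_def mult_Reg mult_trans_im
proof (intro conjI ballI)
  fix f g assume "f \<in> carrier (Reg (trans_im X A))" "g \<in> carrier (Reg (trans_im X A))"
  then have f: "f \<in> X \<rightarrow>\<^sub>E A" "f ` X \<subseteq> f ` A" and g: "g \<in> X \<rightarrow>\<^sub>E A"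
    by (simp_all add: carrier_Reg_trans_im[OF A])
  have "compose X g f \<in> X \<rightarrow>\<^sub>E A"
    using A f g by (intro compose_PiE) (meson PiE_mem subsetD)
  moreover have "compose X g f ` X \<subseteq> compose X g f ` A"
  proof (intro image_subsetI)
    fix x assume x: "x \<in> X"
    then obtain z where z: "z \<in> A" "f x = f z" using f by blast
    then have "compose X g f x = compose X g f z" using x A by (auto simp: compose_def)
    then show "compose X g f x \<in> compose X g f ` A" using z by blast
  qed
  ultimately show "compose X g f \<in> carrier (Reg (trans_im X A))"
    by (simp add: carrier_Reg_trans_im[OF A])
next
  fix f g h assume "f \<in> carrier (Reg (trans_im X A))"
  then have "f \<in> X \<rightarrow>\<^sub>E A" by (simp add: carrier_Reg_trans_im[OF A])
  then have "f \<in> X \<rightarrow> X" using A by auto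
  then show "compose X h (compose X g f) = compose X (compose X h g) f"
    by (rule compose_assoc)
qed

text \<open>The kernel condition passes from the first factor to the product, and injectivity of a
  passes from the image of the second factor to the smaller image of the product.\<close>

lemma is_semigroup_Reg_trans_ker:
  fixes a :: "'b \<Rightarrow> 'a"
  assumes Y: "Y \<noteq> {}"
  shows "is_semigroup (Reg (trans_ker Y (ker_on Y a)))"
  unfolding is_semigroup_def mult_Reg mult_trans_ker
proof (intro conjI ballI)
  fix f g assume "f \<in> carrier (Reg (trans_ker Y (ker_on Y a)))"
    "g \<in> carrier (Reg (trans_ker Y (ker_on Y a)))"
  then have f: "f \<in> Y \<rightarrow>\<^sub>E Y" "ker_on Y a \<subseteq> ker_on Y f"
    and g: "g \<in> Y \<rightarrow>\<^sub>E Y" "inj_on a (g ` Y)"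
    by (simp_all add: carrier_Reg_trans_ker[OF Y])
  have "compose Y g f \<in> Y \<rightarrow>\<^sub>E Y"
    using f g by (intro compose_PiE) auto
  moreover have "ker_on Y a \<subseteq> ker_on Y (compose Y g f)"
    using f by (auto simp: compose_def ker_on_def)
  moreover have "compose Y g f ` Y \<subseteq> g ` Y"
    using f by (auto simp: compose_def)
  then have "inj_on a (compose Y g f ` Y)" by (rule inj_on_subset[OF g(2)])
  ultimately show "compose Y g f \<in> carrier (Reg (trans_ker Y (ker_on Y a)))"
    by (simp add: carrier_Reg_trans_ker[OF Y])
next
  fix f g h assume "f \<in> carrier (Reg (trans_ker Y (ker_on Y a)))"
  then have "f \<in> Y \<rightarrow> Y" by (auto simp: carrier_Reg_trans_ker[OF Y])
  then show "compose Y h (compose Y g f) = compose Y (compose Y h g) f"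
    by (rule compose_assoc)
qed

section \<open>Injectivity and image of the map \<psi>\<close>

text \<open>The image condition on f replaces x by some \<open>a y\<close>, where f and f' agree
  through the second components. The first components give \<open>a (f' (a y)) = a (f' x)\<close>,
  and injectivity of a on the image of f' finishes.\<close>

lemma sandwich_pair_inj:
  assumes a: "a \<in> Y \<rightarrow>\<^sub>E X" and Y: "Y \<noteq> {}"
  shows "inj_on (\<lambda>f. (compose X a f, compose Y f a)) (carrier (Reg (sandwich X Y a)))"
proof (rule inj_onI, clarify)
  fix f f' assume "f \<in> carrier (Reg (sandwich X Y a))" "f' \<in> carrier (Reg (sandwich X Y a))"
    and eq: "compose X a f = compose X a f'" "compose Y f a = compose Y f' a"
  then have f: "f \<in> X \<rightarrow>\<^sub>E Y" "f ` X \<subseteq> f ` a ` Y"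
    and f': "f' \<in> X \<rightarrow>\<^sub>E Y" "inj_on a (f' ` X)"
    by (simp_all add: carrier_Reg_sandwich[OF a Y])
  have eq1: "a (f x) = a (f' x)" if "x \<in> X" for x
    using fun_cong[OF eq(1), of x] that by (simp add: compose_def)
  have eq2: "f (a y) = f' (a y)" if "y \<in> Y" for y
    using fun_cong[OF eq(2), of y] that by (simp add: compose_def)
  have "f x = f' x" if x: "x \<in> X" for x
  proof -
    obtain y where y: "y \<in> Y" "f x = f (a y)" using f x by blast
    have ay: "a y \<in> X" using a y by auto
    have "a (f' (a y)) = a (f' x)" using eq1 x y ay by metis
    then have "f' (a y) = f' x" using f' x ay by (meson imageI inj_onD)
    then show ?thesis using y eq2 by simp
  qed
  then show "f = f'" using f f' by (simp add: PiE_eq_iff)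
qed

text \<open>The image condition on f passes to the first component, injectivity to the second, and
  compatibility is associativity. For the converse, g(X) = g(a(Y)) = a(h(Y)), and the values of g
  are lifted back along a into h(Y).\<close>

lemma sandwich_pair_image:
  assumes a: "a \<in> Y \<rightarrow>\<^sub>E X" and Y: "Y \<noteq> {}"
  shows "(\<lambda>f. (compose X a f, compose Y f a)) ` carrier (Reg (sandwich X Y a)) =
    {(g, h) \<in> carrier (Reg (trans_im X (a ` Y))) \<times> carrier (Reg (trans_ker Y (ker_on Y a))).
       compose Y g a = compose Y a h}" (is "?\<psi> ` ?S = ?P")
proof (intro subset_antisym subsetI)
  have A: "a ` Y \<subseteq> X" "a ` Y \<noteq> {}" using a Y by auto
  note carr = carrier_Reg_sandwich[OF a Y] carrier_Reg_trans_im[OF A] carrier_Reg_trans_ker[OF Y]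
  {
    fix p assume "p \<in> ?\<psi> ` ?S"
    then obtain f where f: "f \<in> X \<rightarrow>\<^sub>E Y" "f ` X \<subseteq> f ` a ` Y" "inj_on a (f ` X)"
      and p: "p = (compose X a f, compose Y f a)"
      by (auto simp: carr)
    have g: "compose X a f x = a (f x)" if "x \<in> X" for x using that by (simp add: compose_def)
    have h: "compose Y f a y = f (a y)" if "y \<in> Y" for y using that by (simp add: compose_def)
    have "compose X a f \<in> X \<rightarrow>\<^sub>E a ` Y"
      using f by (intro compose_PiE) auto
    moreover have "compose X a f ` X \<subseteq> compose X a f ` a ` Y"
    proof (intro image_subsetI)
      fix x assume x: "x \<in> X"
      then obtain y where y: "y \<in> Y" "f x = f (a y)" using f by blast
      then have "compose X a f x = compose X a f (a y)" using x A by (simp add: g image_subset_iff)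
      then show "compose X a f x \<in> compose X a f ` a ` Y" using y by blast
    qed
    moreover have "compose Y f a \<in> Y \<rightarrow>\<^sub>E Y"
      using f a by (intro compose_PiE) (auto simp: PiE_iff)
    moreover have "ker_on Y a \<subseteq> ker_on Y (compose Y f a)"
      by (auto simp: ker_on_def compose_def)
    moreover have "compose Y f a ` Y \<subseteq> f ` X"
      using a by (auto simp: h)
    then have "inj_on a (compose Y f a ` Y)" by (rule inj_on_subset[OF f(3)])
    moreover have "compose Y (compose X a f) a = compose Y a (compose Y f a)"
      using A by (auto simp: compose_def fun_eq_iff)
    ultimately show "p \<in> ?P" by (simp add: p carr h)
  next
    fix p assume "p \<in> ?P"
    then obtain g h where p: "p = (g, h)"
      and g: "g \<in> X \<rightarrow>\<^sub>E a ` Y" "g ` X \<subseteq> g ` a ` Y"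
      and h: "h \<in> Y \<rightarrow>\<^sub>E Y" "inj_on a (h ` Y)"
      and eq: "compose Y g a = compose Y a h"
      by (auto simp: carr)
    have gh: "g (a y) = a (h y)" if "y \<in> Y" for y
      using fun_cong[OF eq, of y] that by (simp add: compose_def)
    have g_im: "g x \<in> a ` h ` Y" if "x \<in> X" for x
    proof -
      have "g x \<in> g ` a ` Y" by (rule subsetD[OF g(2)]) (use that in simp)
      then obtain y where "y \<in> Y" "g x = g (a y)" by (elim imageE) simp
      then show ?thesis using gh by auto
    qed
    \<comment> \<open>This choice is forced: a regular preimage has its image in f(a(Y)) = h(Y),
      where a is injective, and \<open>a (f x) = g x\<close> fixes the value.\<close>
    define f where "f = (\<lambda>x\<in>X. inv_into (h ` Y) a (g x))"
    have fim: "f x \<in> h ` Y" "a (f x) = g x" if "x \<in> X" for x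
      using that g_im[OF that] by (auto simp: f_def inv_into_into f_inv_into_f)
    \<comment> \<open>Both sides lie in h(Y) and have the same image under a.\<close>
    have fa: "f (a y) = h y" if "y \<in> Y" for y
    proof -
      have "a (f (a y)) = a (h y)" "f (a y) \<in> h ` Y"
        using that A gh fim[of "a y"] by auto
      then show ?thesis using h that by (meson imageI inj_onD)
    qed
    have "h ` Y \<subseteq> Y" using h by auto
    then have "f \<in> X \<rightarrow>\<^sub>E Y" using fim by (auto simp: f_def)
    moreover have "f ` X \<subseteq> f ` a ` Y"
      using fim fa by (fastforce simp: image_image)
    moreover have "f ` X \<subseteq> h ` Y" using fim by auto
    then have "inj_on a (f ` X)" by (rule inj_on_subset[OF h(2)])
    ultimately have "f \<in> ?S" by (simp add: carr)
    moreover have "compose X a f = g"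
      using g fim by (auto simp: compose_def fun_eq_iff PiE_iff extensional_def)
    moreover have "compose Y f a = h"
      using h fa by (auto simp: compose_def fun_eq_iff PiE_iff extensional_def)
    ultimately show "p \<in> ?\<psi> ` ?S" unfolding p by blast
  }
qed

section \<open>Generalized inverses of a and the pullback product\<close>

lemma exists_generalized_inverse:
  assumes a: "a \<in> Y \<rightarrow>\<^sub>E X" and Y: "Y \<noteq> {}"
  obtains b where "b \<in> X \<rightarrow>\<^sub>E Y" "compose Y a (compose Y b a) = a" "compose X b (compose X a b) = b"
proof -
  obtain y0 where y0: "y0 \<in> Y" using Y by blast
  \<comment> \<open>A retraction of X onto a(Y). As b picks preimages of \<open>r x\<close>, the
    composite of b and then a is r; since r fixes a(Y) and b is unchanged by applying r first, both
    inverse laws follow.\<close>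
  define r where "r x = (if x \<in> a ` Y then x else a y0)" for x
  define b where "b = (\<lambda>x\<in>X. inv_into Y a (r x))"
  have r: "r x \<in> a ` Y" for x using y0 by (simp add: r_def)
  have b: "b \<in> X \<rightarrow>\<^sub>E Y" using r by (auto simp: b_def intro: inv_into_into)
  have aX: "a y \<in> X" if "y \<in> Y" for y using a that by auto
  have ab: "a (b x) = r x" if "x \<in> X" for x
    using that r by (simp add: b_def f_inv_into_f)
  have "compose Y a (compose Y b a) = a"
    using a aX ab by (auto simp: compose_def fun_eq_iff PiE_iff extensional_def r_def)
  moreover have "b (r x) = b x" if "x \<in> X" for x
    using that aX y0 by (auto simp: b_def r_def)
  then have "compose X b (compose X a b) = b"
    using b ab by (auto simp: compose_def fun_eq_iff PiE_iff extensional_def)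
  ultimately show thesis using that b by blast
qed

text \<open>On a pair (g, h), agreement of \<theta>1 and \<theta>2 amounts to
  \<open>compose Y g a = compose Y a h\<close>, so the carrier of the pullback is the image of
  \<psi> already determined.\<close>

lemma pullback_product_via_sandwich:
  assumes a: "a \<in> Y \<rightarrow>\<^sub>E X" and Y: "Y \<noteq> {}" and b: "b \<in> X \<rightarrow>\<^sub>E Y"
    and aba: "compose Y a (compose Y b a) = a"
  shows "pullback_product_via
    (Reg (sandwich X Y a)) (Reg (trans_im X (a ` Y))) (Reg (trans_ker Y (ker_on Y a)))
    (full_trans (a ` Y))
    (\<lambda>g. restrict (compose X g (compose X a b)) (a ` Y))
    (\<lambda>h. restrict (compose X a (compose X h b)) (a ` Y))
    (\<lambda>f. (compose X a f, compose Y f a))"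
    (is "pullback_product_via ?S ?S1 ?S2 ?T ?\<theta>1 ?\<theta>2 ?\<psi>")
proof -
  let ?A = "a ` Y"
  have A: "?A \<subseteq> X" "?A \<noteq> {}" using a Y by auto
  note carr = carrier_Reg_sandwich[OF a Y] carrier_Reg_trans_im[OF A] carrier_Reg_trans_ker[OF Y]
  have aX: "a y \<in> X" if "y \<in> Y" for y using A that by blast
  have bY: "b x \<in> Y" if "x \<in> X" for x using b that by auto
  have ab: "a (b (a y)) = a y" if "y \<in> Y" for y
    using fun_cong[OF aba, of y] that by (simp add: compose_def)
  have \<theta>1: "?\<theta>1 g = restrict g ?A" for g
    using A ab aX by (auto simp: compose_def fun_eq_iff)
  have \<theta>2: "?\<theta>2 h = (\<lambda>x\<in>?A. a (h (b x)))" for h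
    using A by (auto simp: compose_def fun_eq_iff)
  have "?\<theta>1 \<in> epi ?S1 ?T"
  proof -
    have hom: "?\<theta>1 \<in> hom ?S1 ?T"
    proof (rule homI)
      fix g assume "g \<in> carrier ?S1"
      then show "?\<theta>1 g \<in> carrier ?T"
        unfolding \<theta>1 using A by (auto simp: carr carrier_full_trans PiE_iff)
    next
      fix g g' assume "g \<in> carrier ?S1" "g' \<in> carrier ?S1"
      then show "?\<theta>1 (g \<otimes>\<^bsub>?S1\<^esub> g') = ?\<theta>1 g \<otimes>\<^bsub>?T\<^esub> ?\<theta>1 g'"
        unfolding \<theta>1 mult_Reg mult_trans_im mult_full_trans using A
        by (auto simp: carr compose_def fun_eq_iff PiE_iff)
    qed
    moreover have "t \<in> ?\<theta>1 ` carrier ?S1" if t: "t \<in> ?A \<rightarrow>\<^sub>E ?A" for t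
    proof
      \<comment> \<open>Extends t to X along the retraction x to \<open>a (b x)\<close> onto a(Y);
        the retraction also shows that every value is attained on a(Y).\<close>
      let ?g = "\<lambda>x\<in>X. t (a (b x))"
      show "t = ?\<theta>1 ?g"
        unfolding \<theta>1
        by (rule extensionalityI[of _ ?A]) (use t aX ab in \<open>auto simp: PiE_iff\<close>)
      have "?g \<in> X \<rightarrow>\<^sub>E ?A" using t bY by (auto simp: PiE_iff)
      moreover have "?g ` X \<subseteq> ?g ` ?A"
      proof (intro image_subsetI)
        fix x assume x: "x \<in> X"
        then have "?g x = ?g (a (b x))" using bY ab aX by simp
        then show "?g x \<in> ?g ` ?A" using bY[OF x] by blast
      qed
      ultimately show "?g \<in> carrier ?S1" by (simp add: carr)
    qed
    ultimately show ?thesis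
      using hom_carrier[OF hom] by (auto simp: epi_def carrier_full_trans)
  qed
  moreover have "?\<theta>2 \<in> epi ?S2 ?T"
  proof -
    have hom: "?\<theta>2 \<in> hom ?S2 ?T"
    proof (rule homI)
      fix h assume "h \<in> carrier ?S2"
      then show "?\<theta>2 h \<in> carrier ?T"
        unfolding \<theta>2 using aX bY by (auto simp: carr carrier_full_trans PiE_iff)
    next
      fix h h' assume "h \<in> carrier ?S2" "h' \<in> carrier ?S2"
      then have h: "\<And>y. y \<in> Y \<Longrightarrow> h y \<in> Y" and h': "ker_on Y a \<subseteq> ker_on Y h'"
        by (auto simp: carr)
      \<comment> \<open>\<open>b (a y)\<close> and y lie in one fibre of a, so h' does not separate
        them. This removes the b and a standing between h and h' in the product of the
        images.\<close>
      have "h' (b (a y)) = h' y" if "y \<in> Y" for y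
        using that ab aX bY by (intro ker_on_subsetD[OF h']) auto
      then show "?\<theta>2 (h \<otimes>\<^bsub>?S2\<^esub> h') = ?\<theta>2 h \<otimes>\<^bsub>?T\<^esub> ?\<theta>2 h'"
        unfolding \<theta>2 mult_Reg mult_trans_ker mult_full_trans using h aX bY
        by (auto simp: compose_def fun_eq_iff)
    qed
    moreover have "t \<in> ?\<theta>2 ` carrier ?S2" if t: "t \<in> ?A \<rightarrow>\<^sub>E ?A" for t
    proof
      \<comment> \<open>A lift of t along a: b chooses a preimage of \<open>t (a y)\<close>. It
        factors through a, which gives the kernel condition, and a is injective on the values b
        takes on a(Y).\<close>
      let ?h = "\<lambda>y\<in>Y. b (t (a y))"
      have tA: "t (a y) \<in> ?A" if "y \<in> Y" for y using t that by auto
      have abt: "a (b (t (a y))) = t (a y)" if "y \<in> Y" for y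
        using tA[OF that] ab by auto
      show "t = ?\<theta>2 ?h"
        unfolding \<theta>2
        by (rule extensionalityI[of _ ?A]) (use t bY aX ab abt in \<open>auto simp: PiE_iff\<close>)
      have "?h \<in> Y \<rightarrow>\<^sub>E Y" using tA bY A by auto
      moreover have "ker_on Y a \<subseteq> ker_on Y ?h" by (auto simp: ker_on_def)
      moreover have "inj_on a (?h ` Y)"
        using abt by (auto intro!: inj_onI)
      ultimately show "?h \<in> carrier ?S2" by (simp add: carr)
    qed
    ultimately show ?thesis
      using hom_carrier[OF hom] by (auto simp: epi_def carrier_full_trans)
  qed
  moreover have "?\<psi> \<in> iso ?S (pullback ?S1 ?S2 ?\<theta>1 ?\<theta>2)"
  proof -
    have agree: "?\<theta>1 g = ?\<theta>2 h \<longleftrightarrow> compose Y g a = compose Y a h" if "h \<in> carrier ?S2" for g h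
    proof -
      have "ker_on Y a \<subseteq> ker_on Y h" using that by (simp add: carr)
      then have "h (b (a y)) = h y" if "y \<in> Y" for y
        by (rule ker_on_subsetD) (use that ab aX bY in auto)
      then have "?\<theta>1 g = ?\<theta>2 h \<longleftrightarrow> (\<forall>y\<in>Y. g (a y) = a (h y))"
        unfolding \<theta>1 \<theta>2 by (auto simp: fun_eq_iff restrict_def)
      also have "\<dots> \<longleftrightarrow> compose Y g a = compose Y a h"
        by (auto simp: fun_eq_iff compose_def restrict_def)
      finally show ?thesis .
    qed
    have "carrier (pullback ?S1 ?S2 ?\<theta>1 ?\<theta>2) =
        {(g, h) \<in> carrier ?S1 \<times> carrier ?S2. ?\<theta>1 g = ?\<theta>2 h}"
      by (simp add: pullback_def)
    also have "\<dots> = {(g, h) \<in> carrier ?S1 \<times> carrier ?S2. compose Y g a = compose Y a h}"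
      using agree by blast
    also have "\<dots> = ?\<psi> ` carrier ?S"
      by (rule sandwich_pair_image[OF a Y, symmetric])
    finally have im: "carrier (pullback ?S1 ?S2 ?\<theta>1 ?\<theta>2) = ?\<psi> ` carrier ?S" .
    have "?\<psi> \<in> hom ?S (pullback ?S1 ?S2 ?\<theta>1 ?\<theta>2)"
    proof (rule homI)
      fix f assume "f \<in> carrier ?S"
      then show "?\<psi> f \<in> carrier (pullback ?S1 ?S2 ?\<theta>1 ?\<theta>2)" unfolding im by blast
    next
      fix f f' assume "f \<in> carrier ?S" "f' \<in> carrier ?S"
      then have "f \<in> X \<rightarrow>\<^sub>E Y" "f' \<in> X \<rightarrow>\<^sub>E Y" by (simp_all add: carr)
      \<comment> \<open>With maps written on the right, this is (fag)a = (fa)(ga) and a(fag) =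
        (af)(ag), where g stands for f'.\<close>
      then show "?\<psi> (f \<otimes>\<^bsub>?S\<^esub> f') = ?\<psi> f \<otimes>\<^bsub>pullback ?S1 ?S2 ?\<theta>1 ?\<theta>2\<^esub> ?\<psi> f'"
        using aX by (auto simp: pullback_def DirProd_def mult_Reg mult_sandwich mult_trans_im
            mult_trans_ker compose_def fun_eq_iff PiE_iff)
    qed
    then show ?thesis
      unfolding iso_def bij_betw_def im using sandwich_pair_inj[OF a Y] by simp
  qed
  ultimately show ?thesis
    unfolding pullback_product_via_def
    using is_semigroup_Reg_sandwich[OF a Y] is_semigroup_Reg_trans_im[OF A]
      is_semigroup_Reg_trans_ker[OF Y] is_semigroup_full_trans by blast
qed

theorem theorem3p5:
  fixes X :: "'a set" and Y :: "'b set" and a :: "'b \<Rightarrow> 'a"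
    and A :: "'a set" and \<sigma> :: "('b \<times> 'b) set"
    and \<psi> :: "('a \<Rightarrow> 'b) \<Rightarrow> ('a \<Rightarrow> 'a) \<times> ('b \<Rightarrow> 'b)"
  assumes "X \<noteq> {}" and "Y \<noteq> {}"
    and "a \<in> Y \<rightarrow>\<^sub>E X"
    and "A = a ` Y"
    and "\<sigma> = ker_on Y a"
    and "\<psi> = (\<lambda>f. (compose X a f, compose Y f a))"
  shows "inj_on \<psi> (carrier (Reg (sandwich X Y a)))
    \<and> \<psi> ` carrier (Reg (sandwich X Y a)) =
           {(g, h) \<in> carrier (Reg (trans_im X A)) \<times> carrier (Reg (trans_ker Y \<sigma>)).
              compose Y g a = compose Y a h}
    \<and> (\<forall>b \<in> X \<rightarrow>\<^sub>E Y.
           compose Y a (compose Y b a) = a \<and> compose X b (compose X a b) = b \<longrightarrow>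
           pullback_product_via
             (Reg (sandwich X Y a)) (Reg (trans_im X A)) (Reg (trans_ker Y \<sigma>)) (full_trans A)
             (\<lambda>g. restrict (compose X g (compose X a b)) A)
             (\<lambda>h. restrict (compose X a (compose X h b)) A)
             \<psi>)
    \<and> is_pullback_product
           (Reg (sandwich X Y a)) (Reg (trans_im X A)) (Reg (trans_ker Y \<sigma>)) (full_trans A)"
proof -
  note a = assms(3) and Y = assms(2)
  \<comment> \<open>A concrete b supplies witnesses \<theta>1 and \<theta>2 for the existential form
    of the pullback claim.\<close>
  obtain b where "b \<in> X \<rightarrow>\<^sub>E Y" "compose Y a (compose Y b a) = a"
    using exists_generalized_inverse[OF a Y] by blast
  then have "is_pullback_product
      (Reg (sandwich X Y a)) (Reg (trans_im X A)) (Reg (trans_ker Y \<sigma>)) (full_trans A)"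
    unfolding is_pullback_product_def \<open>A = a ` Y\<close> \<open>\<sigma> = ker_on Y a\<close>
    using pullback_product_via_sandwich[OF a Y] by blast
  then show ?thesis
    using sandwich_pair_inj[OF a Y] sandwich_pair_image[OF a Y]
      pullback_product_via_sandwich[OF a Y]
    unfolding \<open>A = a ` Y\<close> \<open>\<sigma> = ker_on Y a\<close> \<open>\<psi> = _\<close> by blast
qed

end
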